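(* Let $D$ be an oriented link diagram, and let $sr(D)$ be the number of components $D^i$ of $D$ such that $D^i$ has at least one self-crossing. Then $$d(D)+d(-D)+sr(D)\leq c(D).$$ Further, the equality holds if and only if $D$ has property $C$.
   Context: A link diagram $D$ is a diagram (on $\mathbb{S}^2$) of an $r$-component link $L$, $r\ge 1$; $c(D)$ is the number of crossing points of $D$. The component $D^i$ of $D$ is the subdiagram representing the knot component $L^i$ of $L$ (with all other components removed). A crossing point is a self-crossing if both strands belong to the same component, and a non-self crossing otherwise. $-D$ is $D$ with the orientations of all components reversed. Warping degree. A base point sequence ${\bf a}=(a_1,\dots,a_r)$ of an oriented link diagram $D$ is an ordered sequence of points, exactly one on each component, none at a crossing point; the order of ${\bf a}$ determines the order of the components, and we write $D_{\bf a}=D^1_{a_1}\cup\dots\cup D^r_{a_r}$. A self-crossing $p$ of $D^i$ is a warping crossing point of $D^i_{a_i}$ if, travelling along the oriented $D^i$ starting from $a_i$, one meets $p$ first at its under-crossing. For $i<j$, a crossing point $p$ of $D^i$ and $D^j$ is a warping crossing point between $D^i_{a_i}$ and $D^j_{a_j}$ if $D^i$ is the under-strand at $p$. $d(D_{\bf a})$ is the total number of warping crossing points of $D_{\bf a}$ (of both kinds), and $d(D)=\min_{\bf a} d(D_{\bf a})$ over all base point sequences ${\bf a}$ (including all orders of the components). Property $C$. $D$ has property $C$ if every component $D^i$ is an alternating diagram (a component without self-crossings is regarded as alternating), and for each $i\ne j$, in the subdiagram $D^i\cup D^j$ the number of over-crossings of $D^i$ equals the number of under-crossings of $D^i$ (i.e.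 among the crossings between $D^i$ and $D^j$, $D^i$ is the over-strand as often as the under-strand). For $r=1$ property $C$ just means that $D$ is alternating. *)

theory Defs
  imports "HOL-Analysis.Analysis"
begin

text \<open>
  An oriented link diagram on the 2-sphere. Component \<open>i < ncomp D\<close> is the closed curve
  \<open>strand D i\<close>, parametrised with period 1 in the direction of its orientation.
  At a crossing point, \<open>over D i t\<close> tells whether the strand passing through it
  at parameter \<open>t\<close> is the upper one; elsewhere its value carries no information.
\<close>

record link_diagram =
  ncomp :: nat
  strand :: "nat \<Rightarrow> real \<Rightarrow> real^3"
  over :: "nat \<Rightarrow> real \<Rightarrow> bool"

definition passages :: "link_diagram \<Rightarrow> real^3 \<Rightarrow> (nat \<times> real) set" where
  "passages D p = {(i, t). i < ncomp D \<and> 0 \<le> t \<and> t < 1 \<and> strand D i t = p}"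

definition crossings :: "link_diagram \<Rightarrow> (real^3) set" where
  "crossings D = {p. \<exists>x\<in>passages D p. \<exists>y\<in>passages D p. x \<noteq> y}"

text \<open>
  Transversality is stated topologically, so that smooth and piecewise linear diagrams are both
  covered: in a suitable chart \<open>h\<close> the two strands are the coordinate axes of the unit disc.
\<close>

definition crosses_transversally ::
    "(real \<Rightarrow> real^3) \<Rightarrow> real \<Rightarrow> (real \<Rightarrow> real^3) \<Rightarrow> real \<Rightarrow> bool" where
  "crosses_transversally f s g t \<longleftrightarrow>
     (\<exists>e>0. \<exists>U h k. openin (top_of_set (sphere 0 1)) U \<and>
        homeomorphism U (ball (0::complex) 1) h k \<and>
        f ` {s - e<..<s + e} = {x \<in> U. Im (h x) = 0} \<and>
        g ` {t - e<..<t + e} = {x \<in> U. Re (h x) = 0})"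

definition is_link_diagram :: "link_diagram \<Rightarrow> bool" where
  "is_link_diagram D \<longleftrightarrow>
     ncomp D \<ge> 1 \<and>
     (\<forall>i<ncomp D. continuous_on UNIV (strand D i) \<and> range (strand D i) \<subseteq> sphere 0 1 \<and>
        (\<forall>t. strand D i (t + 1) = strand D i t \<and> over D i (t + 1) = over D i t)) \<and>
     finite (crossings D) \<and>
     (\<forall>p\<in>crossings D. card (passages D p) = 2 \<and>
        (\<exists>!x. x \<in> passages D p \<and> over D (fst x) (snd x)) \<and>
        (\<forall>(i, s)\<in>passages D p. \<forall>(j, t)\<in>passages D p. (i, s) \<noteq> (j, t) \<longrightarrow>
           crosses_transversally (strand D i) s (strand D j) t))"

definition crossing_number :: "link_diagram \<Rightarrow> nat" where
  "crossing_number D = card (crossings D)"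

definition reverse :: "link_diagram \<Rightarrow> link_diagram" where
  "reverse D = D\<lparr>strand := \<lambda>i t. strand D i (- t), over := \<lambda>i t. over D i (- t)\<rparr>"

definition component :: "link_diagram \<Rightarrow> nat \<Rightarrow> link_diagram" where
  "component D i = \<lparr>ncomp = 1, strand = \<lambda>_. strand D i, over = \<lambda>_. over D i\<rparr>"

definition self_crossings :: "link_diagram \<Rightarrow> nat \<Rightarrow> (real^3) set" where
  "self_crossings D i =
     {p \<in> crossings D. \<forall>(j, t)\<in>passages D p. j = i}"

definition crossings_between :: "link_diagram \<Rightarrow> nat \<Rightarrow> nat \<Rightarrow> (real^3) set" where
  "crossings_between D i j =
     {p \<in> crossings D. i \<noteq> j \<and> p \<in> range (strand D i) \<and> p \<in> range (strand D j)}"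

definition over_crossings :: "link_diagram \<Rightarrow> nat \<Rightarrow> nat \<Rightarrow> (real^3) set" where
  "over_crossings D i j =
     {p \<in> crossings_between D i j. \<exists>t. strand D i t = p \<and> over D i t}"

definition under_crossings :: "link_diagram \<Rightarrow> nat \<Rightarrow> nat \<Rightarrow> (real^3) set" where
  "under_crossings D i j =
     {p \<in> crossings_between D i j. \<exists>t. strand D i t = p \<and> \<not> over D i t}"

text \<open>
  A base point sequence is a list of pairs (component, parameter of the base point on it); the
  order of the list is the order of the components.
\<close>

definition base_point_sequence :: "link_diagram \<Rightarrow> (nat \<times> real) list \<Rightarrow> bool" where
  "base_point_sequence D as \<longleftrightarrow>
     distinct (map fst as) \<and> set (map fst as) = {..<ncomp D} \<and>
     (\<forall>(i, a)\<in>set as. strand D i a \<notin> crossings D)"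

definition warping_self_crossings :: "link_diagram \<Rightarrow> nat \<Rightarrow> real \<Rightarrow> (real^3) set" where
  "warping_self_crossings D i a =
     {p \<in> self_crossings D i. \<exists>t. a < t \<and> t < a + 1 \<and> strand D i t = p \<and> \<not> over D i t \<and>
        (\<forall>s. a < s \<and> s < t \<longrightarrow> strand D i s \<noteq> p)}"

definition warping_crossings :: "link_diagram \<Rightarrow> (nat \<times> real) list \<Rightarrow> (real^3) set" where
  "warping_crossings D as =
     (\<Union>(i, a)\<in>set as. warping_self_crossings D i a) \<union>
     (\<Union>l<length as. \<Union>k<l. under_crossings D (fst (as ! k)) (fst (as ! l)))"

definition warping_degree_at :: "link_diagram \<Rightarrow> (nat \<times> real) list \<Rightarrow> nat" where
  "warping_degree_at D as = card (warping_crossings D as)"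

definition warping_degree :: "link_diagram \<Rightarrow> nat" where
  "warping_degree D = (LEAST n. \<exists>as. base_point_sequence D as \<and> n = warping_degree_at D as)"

definition sr :: "link_diagram \<Rightarrow> nat" where
  "sr D = card {i. i < ncomp D \<and> self_crossings D i \<noteq> {}}"

text \<open>
  Over- and under-crossings alternate along every component. Since parameters range over all
  reals, consecutive passages across the parameter 0 are included.
\<close>

definition alternating :: "link_diagram \<Rightarrow> bool" where
  "alternating D \<longleftrightarrow>
     (\<forall>i<ncomp D. \<forall>s t. s < t \<and> strand D i s \<in> crossings D \<and> strand D i t \<in> crossings D \<and>
        (\<forall>u. s < u \<and> u < t \<longrightarrow> strand D i u \<notin> crossings D) \<longrightarrow> over D i s \<noteq> over D i t)"

definition property_C :: "link_diagram \<Rightarrow> bool" where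
  "property_C D \<longleftrightarrow>
     (\<forall>i<ncomp D. alternating (component D i)) \<and>
     (\<forall>i<ncomp D. \<forall>j<ncomp D. i \<noteq> j \<longrightarrow>
        card (over_crossings D i j) = card (under_crossings D i j))"

end

theory Submission
  imports Defs
begin

text \<open>
  For every order of the components and every choice of base points, the warping degree is a sum
  of one term per component, which depends only on the base point there, and one term that
  depends only on the order. The two kinds of terms are minimised independently
  (\<open>warping_degree_split\<close>), so both claims can be checked on each of them separately.

  One component with \<open>n > 0\<close> self-crossings. Let \<open>d(a)\<close> be the number of warping self-crossings
  seen from the base point \<open>a\<close>. Every self-crossing is first met under in exactly one of the two
  directions of travel, so reversing the orientation turns \<open>d(a)\<close> into \<open>n - d(a)\<close>; hence the two
  minima add up to \<open>n - (max d - min d)\<close>. When the base point is pushed across an over-passage,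
  the crossing there becomes first met under and \<open>d\<close> grows by one; across an under-passage it
  drops by one (\<open>card_warp_step\<close>). As there are passages, \<open>max d - min d \<ge> 1\<close>, which accounts for
  the summand 1 contributed to \<open>sr\<close>. Along the curve \<open>d\<close> is a walk with steps plus and minus
  one, and such a walk takes only two values exactly when the signs of its steps alternate, that
  is, when the component is alternating (\<open>warping_span\<close>).

  The order of the components. A crossing of two different components is counted for an order
  exactly when it is not counted for the opposite order, so the costs of the two orders add up to
  the number \<open>C\<close> of non-self crossings. Reversing the orientations does not change these costs.
  The minimal cost \<open>m\<close> therefore enters twice, and \<open>2 * m \<le> C\<close>. If equality holds, all orders cost
  the same; exchanging the first two components then shows that either of them lies under the
  other equally often, and the converse is immediate (\<open>min_order_cost\<close>).
\<close>
section \<open>Warping along one closed curve\<close>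

definition first_met_under ::
    "(real \<Rightarrow> 'p) \<Rightarrow> (real \<Rightarrow> bool) \<Rightarrow> 'p set \<Rightarrow> real \<Rightarrow> 'p set" where
  "first_met_under \<gamma> ov X a = {p \<in> X. \<exists>t. a < t \<and> t < a + 1 \<and> \<gamma> t = p \<and> \<not> ov t \<and>
     (\<forall>s. a < s \<and> s < t \<longrightarrow> \<gamma> s \<noteq> p)}"

definition alternating_along :: "(real \<Rightarrow> 'p) \<Rightarrow> (real \<Rightarrow> bool) \<Rightarrow> 'p set \<Rightarrow> bool" where
  "alternating_along \<gamma> ov X \<longleftrightarrow> (\<forall>s t. s < t \<and> \<gamma> s \<in> X \<and> \<gamma> t \<in> X \<and>
     (\<forall>u. s < u \<and> u < t \<longrightarrow> \<gamma> u \<notin> X) \<longrightarrow> ov s \<noteq> ov t)"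

text \<open>
  All later arguments see a base point only through this criterion: of the two passages in the
  period that starts at the base point, the earlier one decides.
\<close>
lemma first_met_under_iff:
  assumes "{t. a < t \<and> t < a + 1 \<and> \<gamma> t = p} = {t1, t2}" "t1 < t2"
  shows "p \<in> first_met_under \<gamma> ov X a \<longleftrightarrow> p \<in> X \<and> \<not> ov t1"
proof -
  have *: "a < t \<and> t < a + 1 \<and> \<gamma> t = p \<longleftrightarrow> t = t1 \<or> t = t2" for t
    using assms(1) by blast
  have t1: "a < t1" "t1 < a + 1" "\<gamma> t1 = p" using *[of t1] by auto
  have before: "\<gamma> s \<noteq> p" if "a < s" "s < t1" for s
    using *[of s] that assms(2) t1(2) by auto
  show ?thesis
  proof
    assume "p \<in> first_met_under \<gamma> ov X a"
    then obtain t where t: "p \<in> X" "a < t" "t < a + 1" "\<gamma> t = p" "\<not> ov t"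
        "\<forall>s. a < s \<and> s < t \<longrightarrow> \<gamma> s \<noteq> p"
      unfolding first_met_under_def by auto
    have "t = t1" using *[of t] t t1 assms(2) by auto
    then show "p \<in> X \<and> \<not> ov t1" using t by simp
  next
    assume "p \<in> X \<and> \<not> ov t1"
    then show "p \<in> first_met_under \<gamma> ov X a"
      unfolding first_met_under_def using t1 before by auto
  qed
qed

lemma periodic_int:
  fixes f :: "real \<Rightarrow> 'b"
  assumes "\<And>t. f (t + 1) = f t"
  shows "f (t + of_int k) = f t"
proof -
  interpret periodic_fun_simple' f by standard (rule assms)
  show ?thesis by (rule plus_of_int)
qed

lemma Least_nat_attained:
  fixes f :: "'a \<Rightarrow> nat"
  assumes "\<exists>x. P x"
  shows "\<exists>x. P x \<and> (LEAST n. \<exists>x. P x \<and> n = f x) = f x \<and> (\<forall>y. P y \<longrightarrow> f x \<le> f y)"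
proof -
  have "\<exists>x. P x \<and> (LEAST n. \<exists>x. P x \<and> n = f x) = f x"
    by (rule LeastI_ex[of "\<lambda>n. \<exists>x. P x \<and> n = f x"]) (use assms in blast)
  moreover have "(LEAST n. \<exists>x. P x \<and> n = f x) \<le> f y" if "P y" for y
    by (rule Least_le) (use that in blast)
  ultimately show ?thesis by metis
qed

text \<open>
  One component of a diagram, seen from inside: \<open>X\<close> is the set of its own double points, while
  \<open>Y\<close> consists of all points that may not serve as base points, including the crossings with
  other components. Only the cyclic sequence of over- and under-passages is recorded.
\<close>
locale double_point_curve =
  fixes \<gamma> :: "real \<Rightarrow> 'p" and ov :: "real \<Rightarrow> bool" and X Y :: "'p set"
  assumes curve_periodic: "\<gamma> (t + 1) = \<gamma> t"
    and over_periodic: "ov (t + 1) = ov t"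
    and subset: "X \<subseteq> Y"
    and finite_parameters: "finite {t. 0 \<le> t \<and> t < 1 \<and> \<gamma> t \<in> Y}"
    and double: "p \<in> X \<Longrightarrow> \<exists>u v. {t. 0 \<le> t \<and> t < 1 \<and> \<gamma> t = p} = {u, v} \<and> ov u \<noteq> ov v"
begin

abbreviation warp :: "real \<Rightarrow> 'p set" where
  "warp \<equiv> first_met_under \<gamma> ov X"

lemma shift [simp]: "\<gamma> (t + of_int k) = \<gamma> t" "ov (t + of_int k) = ov t"
  by (rule periodic_int, rule curve_periodic, rule periodic_int, rule over_periodic)

lemma shift_minus [simp]: "\<gamma> (t - of_int k) = \<gamma> t" "ov (t - of_int k) = ov t"
  using shift[of t "- k"] by simp_all

lemma passages_from:
  assumes "p \<in> X" "\<gamma> a \<notin> X"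
  obtains t1 t2 where "{t. a < t \<and> t < a + 1 \<and> \<gamma> t = p} = {t1, t2}" "t1 < t2" "ov t1 \<noteq> ov t2"
proof -
  obtain u v where uv: "{t. 0 \<le> t \<and> t < 1 \<and> \<gamma> t = p} = {u, v}" "ov u \<noteq> ov v"
    using double[OF assms(1)] by blast
  \<comment> \<open>\<open>w t\<close> is the representative of \<open>t\<close> modulo 1 in \<open>[a, a + 1)\<close>.\<close>
  define w where "w t = t - of_int \<lfloor>t - a\<rfloor>" for t
  have \<gamma>w: "\<gamma> (w t) = \<gamma> t" and ow: "ov (w t) = ov t" for t
    by (simp_all add: w_def)
  have w: "a \<le> w t" "w t < a + 1" for t
    unfolding w_def by linarith+
  have up: "\<gamma> u = p" "\<gamma> v = p" using uv(1) by blast+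
  have sub: "t \<in> {w u, w v}" if "a < t" "t < a + 1" "\<gamma> t = p" for t
  proof -
    define t' where "t' = t - of_int \<lfloor>t\<rfloor>"
    have "0 \<le> t'" "t' < 1" "\<gamma> t' = p"
      unfolding t'_def using that(3) by (linarith, linarith, simp)
    then have "t' \<in> {u, v}" using uv(1) by blast
    moreover have "\<lfloor>t - of_int \<lfloor>t\<rfloor> - a\<rfloor> = - \<lfloor>t\<rfloor>"
      using that by linarith
    then have "w t' = t" by (simp add: w_def t'_def)
    ultimately show ?thesis by auto
  qed
  have "w u \<noteq> a" "w v \<noteq> a" using \<gamma>w up assms by metis+
  then have eq: "{t. a < t \<and> t < a + 1 \<and> \<gamma> t = p} = {w u, w v}"
    using sub w[of u] w[of v] \<gamma>w up by auto
  have ne: "ov (w u) \<noteq> ov (w v)" using ow uv(2) by simp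
  then consider "w u < w v" | "w v < w u" by force
  then show ?thesis
  proof cases
    case 1 then show ?thesis using that eq ne by blast
  next
    case 2 then show ?thesis using that[of "w v" "w u"] eq ne by (simp add: insert_commute)
  qed
qed

lemma passage_exists:
  assumes "p \<in> X"
  shows "\<exists>t. 0 \<le> t \<and> t < 1 \<and> \<gamma> t = p"
proof -
  obtain u v where "{t. 0 \<le> t \<and> t < 1 \<and> \<gamma> t = p} = {u, v}" using double[OF assms] by blast
  then have "u \<in> {t. 0 \<le> t \<and> t < 1 \<and> \<gamma> t = p}" by simp
  then show ?thesis by blast
qed

lemma other_passage:
  assumes "\<gamma> s \<in> X"
  obtains t where "s < t" "t < s + 1" "\<gamma> t = \<gamma> s" "ov t \<noteq> ov s"
proof -
  obtain u v where uv: "{t. 0 \<le> t \<and> t < 1 \<and> \<gamma> t = \<gamma> s} = {u, v}" "ov u \<noteq> ov v"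
    using double[OF assms(1)] by blast
  then obtain x where x: "\<gamma> x = \<gamma> s" "ov x \<noteq> ov s" by blast
  define t where "t = x - of_int \<lfloor>x - s\<rfloor>"
  have t: "\<gamma> t = \<gamma> s" "ov t \<noteq> ov s" using x by (simp_all add: t_def)
  moreover have "s \<le> t" "t < s + 1" unfolding t_def by linarith+
  ultimately show ?thesis using that by (metis order_le_less)
qed

lemma finite_double_points: "finite X"
proof (rule finite_surj[OF finite_parameters, of _ \<gamma>], rule subsetI)
  fix p assume "p \<in> X"
  then obtain u where "0 \<le> u \<and> u < 1 \<and> \<gamma> u = p" using passage_exists by blast
  then show "p \<in> \<gamma> ` {t. 0 \<le> t \<and> t < 1 \<and> \<gamma> t \<in> Y}" using subset \<open>p \<in> X\<close> by blast
qed

lemma finite_warp: "finite (warp a)"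
  unfolding first_met_under_def using finite_double_points by simp

lemma finite_parameters_between: "finite {t. a \<le> t \<and> t \<le> b \<and> \<gamma> t \<in> Y}"
proof (rule finite_subset)
  show "{t. a \<le> t \<and> t \<le> b \<and> \<gamma> t \<in> Y} \<subseteq>
      (\<lambda>(t, k). t + of_int k) ` ({t. 0 \<le> t \<and> t < 1 \<and> \<gamma> t \<in> Y} \<times> {\<lfloor>a\<rfloor>..\<lfloor>b\<rfloor>})"
  proof
    fix t assume t: "t \<in> {t. a \<le> t \<and> t \<le> b \<and> \<gamma> t \<in> Y}"
    have "(t - of_int \<lfloor>t\<rfloor>, \<lfloor>t\<rfloor>) \<in> {t. 0 \<le> t \<and> t < 1 \<and> \<gamma> t \<in> Y} \<times> {\<lfloor>a\<rfloor>..\<lfloor>b\<rfloor>}"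
      using t by (auto intro: floor_mono) linarith
    then show "t \<in> (\<lambda>(t, k). t + of_int k) ` ({t. 0 \<le> t \<and> t < 1 \<and> \<gamma> t \<in> Y} \<times> {\<lfloor>a\<rfloor>..\<lfloor>b\<rfloor>})"
      by (rule rev_image_eqI) simp
  qed
qed (use finite_parameters in auto)

lemma isolated: "\<exists>e>0. \<forall>u. \<bar>u - x\<bar> < e \<and> u \<noteq> x \<longrightarrow> \<gamma> u \<notin> Y"
proof -
  obtain d where d: "d > 0" "\<And>u. u \<in> {t. x - 1 \<le> t \<and> t \<le> x + 1 \<and> \<gamma> t \<in> Y} \<Longrightarrow> u \<noteq> x \<Longrightarrow> d \<le> dist x u"
    using finite_set_avoid[OF finite_parameters_between[of "x - 1" "x + 1"], of x] by blast
  have "\<gamma> u \<notin> Y" if "\<bar>u - x\<bar> < min d 1 \<and> u \<noteq> x" for u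
    using d(2)[of u] that by (auto simp: dist_real_def abs_if split: if_splits)
  moreover have "min d 1 > 0" using d by simp
  ultimately show ?thesis by blast
qed

text \<open>
  Passages are isolated, so a base point can be placed so close to a given parameter that no
  passage lies between the two.
\<close>
lemma base_point_before:
  assumes "c < x"
  shows "\<exists>a. c < a \<and> a < x \<and> (\<forall>u. a \<le> u \<and> u < x \<longrightarrow> \<gamma> u \<notin> Y)"
proof -
  obtain e where e: "e > 0" "\<forall>u. \<bar>u - x\<bar> < e \<and> u \<noteq> x \<longrightarrow> \<gamma> u \<notin> Y"
    using isolated[of x] by blast
  obtain a where a: "max c (x - e) < a" "a < x"
    using dense[of "max c (x - e)" x] assms e(1) by auto
  then have "\<forall>u. a \<le> u \<and> u < x \<longrightarrow> \<gamma> u \<notin> Y" using e(2) by auto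
  then show ?thesis using a by auto
qed

lemma base_point_after:
  assumes "x < c"
  shows "\<exists>a. x < a \<and> a < c \<and> (\<forall>u. x < u \<and> u \<le> a \<longrightarrow> \<gamma> u \<notin> Y)"
proof -
  obtain e where e: "e > 0" "\<forall>u. \<bar>u - x\<bar> < e \<and> u \<noteq> x \<longrightarrow> \<gamma> u \<notin> Y"
    using isolated[of x] by blast
  obtain a where a: "x < a" "a < min c (x + e)"
    using dense[of x "min c (x + e)"] assms e(1) by auto
  then have "\<forall>u. x < u \<and> u \<le> a \<longrightarrow> \<gamma> u \<notin> Y" using e(2) by auto
  then show ?thesis using a by auto
qed

lemma base_point_exists: "\<exists>a. \<gamma> a \<notin> Y"
  using base_point_after[of 0 1] by auto

lemma next_passage:
  assumes "X \<noteq> {}"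
  shows "\<exists>t. a < t \<and> t \<le> a + 1 \<and> \<gamma> t \<in> X \<and> (\<forall>u. a < u \<and> u < t \<longrightarrow> \<gamma> u \<notin> X)"
proof -
  let ?S = "{t. a < t \<and> t \<le> a + 1 \<and> \<gamma> t \<in> X}"
  obtain p where "p \<in> X" using assms by blast
  then obtain x where x: "\<gamma> x \<in> X" using passage_exists by blast
  define y where "y = x + of_int (1 + \<lfloor>a - x\<rfloor>)"
  have "\<gamma> y \<in> X" unfolding y_def using x by (simp only: shift)
  moreover have "a < y" "y \<le> a + 1" unfolding y_def by linarith+
  ultimately have ne: "?S \<noteq> {}" by blast
  have fin: "finite ?S"
    by (rule finite_subset[OF _ finite_parameters_between[of a "a + 1"]]) (use subset in auto)
  have M: "Min ?S \<in> ?S" by (rule Min_in[OF fin ne])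
  have "\<gamma> u \<notin> X" if "a < u" "u < Min ?S" for u
  proof
    assume "\<gamma> u \<in> X"
    then have "u \<in> ?S" using that M by auto
    then show False using that(2) Min_le[OF fin] by (meson linorder_not_le)
  qed
  then show ?thesis using M by blast
qed

text \<open>
  Moving the base point from \<open>a\<close> to \<open>b\<close> transfers the parameters in \<open>(a, b)\<close> to the end of the
  period; a double point with no passage there keeps its two passages in the same order.
\<close>
lemma warp_iff_unpassed:
  assumes "p \<in> X" "a < b" "b < a + 1" "\<gamma> a \<notin> X" "\<gamma> b \<notin> X"
    and no: "\<And>u. a < u \<Longrightarrow> u < b \<Longrightarrow> \<gamma> u \<noteq> p"
  shows "p \<in> warp b \<longleftrightarrow> p \<in> warp a"
proof -
  obtain t1 t2 where t: "{t. a < t \<and> t < a + 1 \<and> \<gamma> t = p} = {t1, t2}" "t1 < t2" "ov t1 \<noteq> ov t2"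
    by (rule passages_from[OF assms(1,4)])
  have low: "\<gamma> u \<noteq> p" if "a < u" "u \<le> b" for u
    using no[of u] that assms(1,5) by (cases "u = b") auto
  have high: "\<gamma> u \<noteq> p" if "a + 1 \<le> u" "u < b + 1" for u
    using no[of "u - 1"] that shift_minus(1)[of u 1] assms(1,4) by (cases "u = a + 1") auto
  have "b < s \<and> s < b + 1 \<and> \<gamma> s = p \<longleftrightarrow> a < s \<and> s < a + 1 \<and> \<gamma> s = p" for s
  proof (cases "\<gamma> s = p")
    case True
    then have "\<not> (a + 1 \<le> s \<and> s < b + 1)" "\<not> (a < s \<and> s \<le> b)" using low high by blast+
    then show ?thesis using True assms(2,3) by linarith
  qed simp
  then have "{t. b < t \<and> t < b + 1 \<and> \<gamma> t = p} = {t1, t2}"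
    using t(1) by simp
  from first_met_under_iff[OF this t(2), of ov X] first_met_under_iff[OF t(1,2), of ov X]
  show ?thesis by simp
qed

lemma warp_unchanged:
  assumes "X \<noteq> {}" "a < b" "\<And>u. a \<le> u \<Longrightarrow> u \<le> b \<Longrightarrow> \<gamma> u \<notin> X"
  shows "warp b = warp a"
proof -
  have "b < a + 1"
  proof (rule ccontr)
    assume "\<not> b < a + 1"
    moreover obtain t where "a < t" "t \<le> a + 1" "\<gamma> t \<in> X"
      using next_passage[OF assms(1), of a] by blast
    ultimately show False using assms(3)[of t] by simp
  qed
  then have "p \<in> warp b \<longleftrightarrow> p \<in> warp a" if "p \<in> X" for p
    by (intro warp_iff_unpassed[OF that assms(2)] notI)
      (use assms(2) assms(3)[of a] assms(3)[of b] assms(3) that in auto)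
  then show ?thesis unfolding first_met_under_def by blast
qed

text \<open>
  The single passage \<open>t\<close> between \<open>a\<close> and \<open>b\<close> is the first passage of its double point as seen from
  \<open>a\<close>, and the last one, at \<open>t + 1\<close>, as seen from \<open>b\<close>. Since the other passage lies on the opposite
  level, the status of this double point is toggled, and no other one is affected.
\<close>
lemma card_warp_step:
  assumes "a < t" "t < b" "b < a + 1" "\<gamma> t \<in> X"
    and no: "\<And>u. a \<le> u \<Longrightarrow> u \<le> b \<Longrightarrow> u \<noteq> t \<Longrightarrow> \<gamma> u \<notin> X"
  shows "card (warp b) + of_bool (\<not> ov t) = card (warp a) + of_bool (ov t)"
proof -
  let ?q = "\<gamma> t"
  have ab: "\<gamma> a \<notin> X" "\<gamma> b \<notin> X" using no assms(1,2,3) by auto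
  have others: "p \<in> warp b \<longleftrightarrow> p \<in> warp a" if "p \<noteq> ?q" for p
  proof (cases "p \<in> X")
    case True
    have "\<gamma> u \<noteq> p" if "a < u" "u < b" for u
      using no[of u] that True \<open>p \<noteq> ?q\<close> by (cases "u = t") auto
    then show ?thesis using warp_iff_unpassed[OF True, of a b] ab assms(1-3) by auto
  qed (simp add: first_met_under_def)
  obtain t1 t2 where t: "{s. a < s \<and> s < a + 1 \<and> \<gamma> s = ?q} = {t1, t2}" "t1 < t2" "ov t1 \<noteq> ov t2"
    by (rule passages_from[OF assms(4) ab(1)])
  have iff: "a < s \<and> s < a + 1 \<and> \<gamma> s = ?q \<longleftrightarrow> s = t1 \<or> s = t2" for s
    using t(1) by blast
  have t1: "t1 = t"
  proof (rule ccontr)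
    assume "t1 \<noteq> t"
    then have "t2 = t" using iff[of t] assms(1-3) by auto
    then show False using no[of t1] iff[of t1] t(2) assms(2,4) \<open>t1 \<noteq> t\<close> by auto
  qed
  have t2: "b < t2"
  proof (rule ccontr)
    assume "\<not> b < t2"
    then show False using no[of t2] iff[of t2] t(2) t1 assms(4) by auto
  qed
  have "{s. b < s \<and> s < b + 1 \<and> \<gamma> s = ?q} = {t2, t + 1}"
  proof (intro set_eqI iffI)
    fix s assume s: "s \<in> {s. b < s \<and> s < b + 1 \<and> \<gamma> s = ?q}"
    show "s \<in> {t2, t + 1}"
    proof (cases "s < a + 1")
      case True
      then show ?thesis using iff[of s] s assms(1,2) t1 by auto
    next
      case False
      have "\<gamma> (s - 1) = ?q" using s shift_minus(1)[of s 1] by simp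
      then show ?thesis using no[of "s - 1"] s False assms(4) by (cases "s = t + 1") auto
    qed
  next
    fix s assume "s \<in> {t2, t + 1}"
    then show "s \<in> {s. b < s \<and> s < b + 1 \<and> \<gamma> s = ?q}"
      using iff[of t2] t2 assms(1-3) curve_periodic[of t] by auto
  qed
  moreover have "t2 < t + 1" using iff[of t2] assms(1) by auto
  ultimately have qb: "?q \<in> warp b \<longleftrightarrow> \<not> ov t2"
    using first_met_under_iff[of b \<gamma> ?q t2 "t + 1" ov X] assms(4) by simp
  have qa: "?q \<in> warp a \<longleftrightarrow> \<not> ov t"
    using first_met_under_iff[OF t(1,2)] t1 assms(4) by simp
  show ?thesis
  proof (cases "ov t")
    case True
    then have "?q \<notin> warp a" "?q \<in> warp b" using qa qb t(3) t1 by simp_all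
    moreover from this have "warp b = insert ?q (warp a)"
      by (intro set_eqI) (metis insert_iff others)
    ultimately show ?thesis using True finite_warp by simp
  next
    case False
    then have "?q \<notin> warp b" "?q \<in> warp a" using qa qb t(3) t1 by simp_all
    moreover from this have "warp a = insert ?q (warp b)"
      by (intro set_eqI) (metis insert_iff others)
    ultimately show ?thesis using False finite_warp by simp
  qed
qed

lemma ex_warp_increment:
  assumes "X \<noteq> {}"
  shows "\<exists>a b. \<gamma> a \<notin> Y \<and> \<gamma> b \<notin> Y \<and> card (warp b) = card (warp a) + 1"
proof -
  obtain p where "p \<in> X" using assms by blast
  then obtain t0 where "\<gamma> t0 \<in> X" using passage_exists by blast
  moreover from this obtain t1 where "\<gamma> t1 = \<gamma> t0" "ov t1 \<noteq> ov t0" by (rule other_passage)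
  ultimately obtain t where t: "\<gamma> t \<in> X" "ov t" by metis
  obtain a where a: "t - 1/2 < a" "a < t" "\<And>u. a \<le> u \<Longrightarrow> u < t \<Longrightarrow> \<gamma> u \<notin> Y"
    using base_point_before[of "t - 1/2" t] by force
  obtain b where b: "t < b" "b < t + 1/2" "\<And>u. t < u \<Longrightarrow> u \<le> b \<Longrightarrow> \<gamma> u \<notin> Y"
    using base_point_after[of t "t + 1/2"] by force
  have "\<gamma> u \<notin> X" if "a \<le> u" "u \<le> b" "u \<noteq> t" for u
    using a(3)[of u] b(3)[of u] that subset by (cases "u < t") auto
  then have "card (warp b) + of_bool (\<not> ov t) = card (warp a) + of_bool (ov t)"
    using card_warp_step[of a t b] a b t by auto
  then show ?thesis using a(2,3) b(1,3) t(2) by auto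
qed

text \<open>
  On an alternating curve the steps cancel in pairs, so \<open>card (warp a)\<close> depends only on the level of
  the next passage after \<open>a\<close>: it is a constant, plus one if that passage is an under-passage. The
  induction consumes the passages between \<open>a\<close> and \<open>b\<close> one by one.
\<close>
lemma card_warp_of_next:
  assumes alt: "alternating_along \<gamma> ov X" and "X \<noteq> {}"
    and "a < b" "\<gamma> a \<notin> Y" "\<gamma> b \<notin> Y"
    and "a < s" "\<gamma> s \<in> X" "\<And>u. a < u \<Longrightarrow> u < s \<Longrightarrow> \<gamma> u \<notin> X"
    and "b < t" "\<gamma> t \<in> X" "\<And>u. b < u \<Longrightarrow> u < t \<Longrightarrow> \<gamma> u \<notin> X"
  shows "card (warp b) + of_bool (\<not> ov s) = card (warp a) + of_bool (\<not> ov t)"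
  using assms(3-)
proof (induction "card {u. a < u \<and> u < b \<and> \<gamma> u \<in> X}" arbitrary: a s rule: less_induct)
  case less
  have fin: "finite {u. a < u \<and> u < b \<and> \<gamma> u \<in> X}"
    by (rule finite_subset[OF _ finite_parameters_between[of a b]]) (use subset in auto)
  have aX: "\<gamma> a \<notin> X" and bX: "\<gamma> b \<notin> X" using less.prems(2,3) subset by blast+
  show ?case
  proof (cases "b < s")
    case True
    then have "s = t"
      using less.prems(6)[of t] less.prems(5) less.prems(7-8) less.prems(9)[of s] \<open>a < b\<close> 
      by (cases s t rule: linorder_cases) auto
    moreover have "\<gamma> u \<notin> X" if "a \<le> u" "u \<le> b" for u
      using less.prems(6)[of u] that aX True by (cases "u = a") auto
    ultimately show ?thesis using warp_unchanged[of a b] \<open>X \<noteq> {}\<close> \<open>a < b\<close> by simp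
  next
    case False
    then have "s < b" using bX less.prems(5) by (cases "s = b") auto
    obtain n where n: "a < n" "n \<le> a + 1" "\<gamma> n \<in> X"
      using next_passage[OF \<open>X \<noteq> {}\<close>, of a] by blast
    have "n \<noteq> a + 1" using n(3) aX curve_periodic[of a] by auto
    moreover have "s \<le> n" using n less.prems(6)[of n] by (meson linorder_not_le)
    ultimately have "s < a + 1" using n(2) by simp
    obtain r where r: "s < r" "\<gamma> r \<in> X" "\<And>u. s < u \<Longrightarrow> u < r \<Longrightarrow> \<gamma> u \<notin> X"
      using next_passage[OF \<open>X \<noteq> {}\<close>, of s] by blast
    have flip: "ov s \<noteq> ov r"
      using alt r less.prems(5) unfolding alternating_along_def by blast
    obtain m where m: "s < m" "m < Min {b, a + 1, r}" "\<And>u. s < u \<Longrightarrow> u \<le> m \<Longrightarrow> \<gamma> u \<notin> Y"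
      using base_point_after[of s "Min {b, a + 1, r}"] \<open>s < b\<close> \<open>s < a + 1\<close> \<open>s < r\<close>
      by force
    then have m': "m < b" "m < a + 1" "m < r" "\<gamma> m \<notin> Y" by auto
    have only: "\<gamma> u \<notin> X" if "a \<le> u" "u \<le> m" "u \<noteq> s" for u
      using less.prems(6)[of u] m(3)[of u] subset that aX by (cases "u = a"; cases "u < s") auto
    have step: "card (warp m) + of_bool (\<not> ov s) = card (warp a) + of_bool (ov s)"
      by (rule card_warp_step) (use less.prems m m' only in auto)
    have "{u. m < u \<and> u < b \<and> \<gamma> u \<in> X} \<subset> {u. a < u \<and> u < b \<and> \<gamma> u \<in> X}"
    proof
      show "{u. m < u \<and> u < b \<and> \<gamma> u \<in> X} \<subseteq> {u. a < u \<and> u < b \<and> \<gamma> u \<in> X}"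
        using less.prems(4) m(1) by auto
      have "s \<in> {u. a < u \<and> u < b \<and> \<gamma> u \<in> X}" "s \<notin> {u. m < u \<and> u < b \<and> \<gamma> u \<in> X}"
        using less.prems(4,5) m(1) \<open>s < b\<close> by auto
      then show "{u. m < u \<and> u < b \<and> \<gamma> u \<in> X} \<noteq> {u. a < u \<and> u < b \<and> \<gamma> u \<in> X}" by blast
    qed
    then have "card {u. m < u \<and> u < b \<and> \<gamma> u \<in> X} < card {u. a < u \<and> u < b \<and> \<gamma> u \<in> X}"
      by (rule psubset_card_mono[OF fin])
    then have "card (warp b) + of_bool (\<not> ov r) = card (warp m) + of_bool (\<not> ov t)"
      by (rule less.hyps) (use m' m(1) r less.prems in auto)
    then show ?thesis using step flip by (auto split: if_splits)
  qed
qed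

lemma warp_range_alternating:
  assumes "alternating_along \<gamma> ov X" "X \<noteq> {}" "\<gamma> a \<notin> Y" "\<gamma> b \<notin> Y"
  shows "card (warp b) \<le> card (warp a) + 1"
proof -
  obtain s where s: "a < s" "\<gamma> s \<in> X" "\<And>u. a < u \<Longrightarrow> u < s \<Longrightarrow> \<gamma> u \<notin> X"
    using next_passage[OF assms(2), of a] by blast
  obtain t where t: "b < t" "\<gamma> t \<in> X" "\<And>u. b < u \<Longrightarrow> u < t \<Longrightarrow> \<gamma> u \<notin> X"
    using next_passage[OF assms(2), of b] by blast
  consider "a < b" | "b < a" | "a = b" by linarith
  then show ?thesis
  proof cases
    case 1
    from card_warp_of_next[OF assms(1,2) 1 assms(3,4) s t] show ?thesis
      by (auto simp: of_bool_def split: if_splits)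
  next
    case 2
    from card_warp_of_next[OF assms(1,2) 2 assms(4,3) t s] show ?thesis
      by (auto simp: of_bool_def split: if_splits)
  qed simp
qed

text \<open>
  Two consecutive passages on the same level would produce two steps in the same direction, and
  hence two base points whose counts differ by two.
\<close>
lemma alternating_if_warp_range:
  assumes range: "\<And>a b. \<gamma> a \<notin> Y \<Longrightarrow> \<gamma> b \<notin> Y \<Longrightarrow> card (warp b) \<le> card (warp a) + 1"
  shows "alternating_along \<gamma> ov X"
  unfolding alternating_along_def
proof (intro allI impI notI; elim conjE)
  fix s t assume st: "s < t" "\<gamma> s \<in> X" "\<gamma> t \<in> X" "\<forall>u. s < u \<and> u < t \<longrightarrow> \<gamma> u \<notin> X"
    and eq: "ov s = ov t"
  \<comment> \<open>The second passage through \<open>\<gamma> s\<close> occurs before \<open>s + 1\<close>, so \<open>t\<close> does as well. This keeps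
    both steps below within one period, as \<open>card_warp_step\<close> demands.\<close>
  obtain s' where "s < s'" "s' < s + 1" "\<gamma> s' = \<gamma> s"
    using other_passage[OF st(2)] by metis
  then have "t < s + 1" using st(2,4) by (metis linorder_not_le order.strict_trans2)
  obtain m where m: "s < m" "m < t" "\<gamma> m \<notin> Y"
    using base_point_after[OF st(1)] by blast
  obtain a where a: "t - 1 < a" "a < s" "\<And>u. a \<le> u \<Longrightarrow> u < s \<Longrightarrow> \<gamma> u \<notin> Y"
    using base_point_before[of "t - 1" s] \<open>t < s + 1\<close> by force
  obtain b where b: "t < b" "b < m + 1" "\<And>u. t < u \<Longrightarrow> u \<le> b \<Longrightarrow> \<gamma> u \<notin> Y"
    using base_point_after[of t "m + 1"] \<open>t < s + 1\<close> m by force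
  have "card (warp m) + of_bool (\<not> ov s) = card (warp a) + of_bool (ov s)"
  proof (rule card_warp_step)
    show "\<gamma> u \<notin> X" if "a \<le> u" "u \<le> m" "u \<noteq> s" for u
      using a(3)[of u] subset st(4) that m by (cases "u < s") auto
  qed (use a m st in auto)
  moreover have "card (warp b) + of_bool (\<not> ov t) = card (warp m) + of_bool (ov t)"
  proof (rule card_warp_step)
    show "\<gamma> u \<notin> X" if "m \<le> u" "u \<le> b" "u \<noteq> t" for u
      using b(3)[of u] subset st(4) that m by (cases "u < t") auto
  qed (use b m st in auto)
  moreover have "\<gamma> a \<notin> Y" "\<gamma> b \<notin> Y" using a b by auto
  ultimately show False
    using range[of a b] range[of b a] eq by (cases "ov s") auto
qed

text \<open>
  Travelling backwards from the same base point exchanges the first and the last passage of every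
  double point, and exactly one of the two is an under-passage.
\<close>
lemma warp_reverse:
  assumes "\<gamma> a \<notin> X"
  shows "first_met_under (\<lambda>t. \<gamma> (- t)) (\<lambda>t. ov (- t)) X (- a) = X - warp a"
proof -
  have "p \<in> first_met_under (\<lambda>t. \<gamma> (- t)) (\<lambda>t. ov (- t)) X (- a) \<longleftrightarrow> p \<notin> warp a" if pX: "p \<in> X" for p
  proof -
    obtain t1 t2 where t: "{t. a < t \<and> t < a + 1 \<and> \<gamma> t = p} = {t1, t2}" "t1 < t2" "ov t1 \<noteq> ov t2"
      by (rule passages_from[OF pX assms])
    have per: "\<gamma> (- s) = \<gamma> (1 - s)" "ov (- s) = ov (1 - s)" for s
      using curve_periodic[of "- s"] over_periodic[of "- s"] by (simp_all add: add.commute)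
    have iff: "a < s \<and> s < a + 1 \<and> \<gamma> s = p \<longleftrightarrow> s = t1 \<or> s = t2" for s
      using t(1) by blast
    have "{s. - a < s \<and> s < - a + 1 \<and> \<gamma> (- s) = p} = {1 - t2, 1 - t1}"
    proof (intro set_eqI)
      fix s show "s \<in> {s. - a < s \<and> s < - a + 1 \<and> \<gamma> (- s) = p} \<longleftrightarrow> s \<in> {1 - t2, 1 - t1}"
        using iff[of "1 - s"] per(1)[of s] by auto
    qed
    from first_met_under_iff[OF this] first_met_under_iff[OF t(1,2)] show ?thesis
      using t pX per(2)[of "1 - t2"] by simp
  qed
  then show ?thesis unfolding first_met_under_def by blast
qed

text \<open>
  By \<open>warp_reverse\<close>, \<open>lo_rev\<close> is the minimum for the reversed curve. It equals \<open>card X\<close> minus the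
  largest value of \<open>card (warp a)\<close>, so the statement is about the difference between the largest
  and the smallest value.
\<close>
theorem warping_span:
  defines "lo \<equiv> LEAST n. \<exists>a. \<gamma> a \<notin> Y \<and> n = card (warp a)"
    and "lo_rev \<equiv> LEAST n. \<exists>a. \<gamma> a \<notin> Y \<and> n = card (X - warp a)"
  shows "lo + lo_rev + of_bool (X \<noteq> {}) \<le> card X"
    and "lo + lo_rev + of_bool (X \<noteq> {}) = card X \<longleftrightarrow> alternating_along \<gamma> ov X"
proof -
  have sub: "warp a \<subseteq> X" for a by (auto simp: first_met_under_def)
  have compl: "card (X - warp a) = card X - card (warp a)" for a
    by (rule card_Diff_subset[OF finite_warp sub])
  have le: "card (warp a) \<le> card X" for a
    by (rule card_mono[OF finite_double_points sub])
  obtain a where a: "\<gamma> a \<notin> Y" "lo = card (warp a)" "\<And>c. \<gamma> c \<notin> Y \<Longrightarrow> card (warp a) \<le> card (warp c)"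
    using Least_nat_attained[OF base_point_exists, of "\<lambda>a. card (warp a)"] unfolding lo_def by blast
  obtain b where b: "\<gamma> b \<notin> Y" "lo_rev = card (X - warp b)"
      "\<And>c. \<gamma> c \<notin> Y \<Longrightarrow> card (X - warp b) \<le> card (X - warp c)"
    using Least_nat_attained[OF base_point_exists, of "\<lambda>a. card (X - warp a)"]
    unfolding lo_rev_def by blast
  have bmax: "card (warp c) \<le> card (warp b)" if "\<gamma> c \<notin> Y" for c
    using b(3)[OF that] le[of b] le[of c] by (simp add: compl)
  have "lo + lo_rev + of_bool (X \<noteq> {}) \<le> card X \<and>
    (lo + lo_rev + of_bool (X \<noteq> {}) = card X \<longleftrightarrow> alternating_along \<gamma> ov X)"
  proof (cases "X = {}")
    case True
    then show ?thesis using le[of a] a(2) b(2) compl by (simp add: alternating_along_def)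
  next
    case False
    have up: "card (warp a) + 1 \<le> card (warp b)"
      using ex_warp_increment[OF False] a(3) bmax by fastforce
    have "card (warp b) \<le> card (warp a) + 1 \<longleftrightarrow> alternating_along \<gamma> ov X"
    proof
      assume "card (warp b) \<le> card (warp a) + 1"
      then have "card (warp d) \<le> card (warp c) + 1" if "\<gamma> c \<notin> Y" "\<gamma> d \<notin> Y" for c d
        using a(3)[OF that(1)] bmax[OF that(2)] by linarith
      then show "alternating_along \<gamma> ov X" by (rule alternating_if_warp_range)
    qed (use warp_range_alternating[OF _ False a(1) b(1)] in blast)
    then show ?thesis using up le[of b] False a(2) b(2) compl[of b] by auto
  qed
  then show "lo + lo_rev + of_bool (X \<noteq> {}) \<le> card X"
    and "lo + lo_rev + of_bool (X \<noteq> {}) = card X \<longleftrightarrow> alternating_along \<gamma> ov X" by blast+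
qed

end

section \<open>Ordering the components\<close>

text \<open>
  \<open>u x y\<close> is the price of placing \<open>x\<close> before \<open>y\<close>; for a diagram it is the number of crossings at
  which component \<open>x\<close> runs under component \<open>y\<close>. The double sum follows the shape of the union in
  the definition of the warping crossings.
\<close>
definition order_cost :: "('a \<Rightarrow> 'a \<Rightarrow> nat) \<Rightarrow> 'a list \<Rightarrow> nat" where
  "order_cost u \<sigma> = (\<Sum>l<length \<sigma>. \<Sum>k<l. u (\<sigma> ! k) (\<sigma> ! l))"

lemma order_cost_Nil [simp]: "order_cost u [] = 0"
  by (simp add: order_cost_def)

lemma order_cost_Cons [simp]:
  "order_cost u (x # xs) = sum_list (map (u x) xs) + order_cost u xs"
  unfolding order_cost_def
  by (simp add: sum.lessThan_Suc_shift sum.distrib sum_list_sum_nth atLeast0LessThan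
      del: sum.lessThan_Suc)

lemma order_cost_snoc:
  "order_cost u (xs @ [x]) = order_cost u xs + sum_list (map (\<lambda>y. u y x) xs)"
  by (induction xs) simp_all

lemma order_cost_rev: "order_cost u (rev \<sigma>) = order_cost (\<lambda>x y. u y x) \<sigma>"
proof (induction \<sigma>)
  case (Cons x xs)
  have "sum_list (map (\<lambda>y. u y x) (rev xs)) = sum_list (map (\<lambda>y. u y x) xs)"
    by (simp flip: rev_map)
  then show ?case using Cons by (simp add: order_cost_snoc)
qed simp

text \<open>
  Every ordered pair of distinct elements is priced by exactly one of the two lists.
\<close>
lemma order_cost_plus_rev:
  assumes "distinct \<sigma>"
  shows "order_cost u \<sigma> + order_cost u (rev \<sigma>) = (\<Sum>x\<in>set \<sigma>. \<Sum>y\<in>set \<sigma> - {x}. u x y)"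
  unfolding order_cost_rev using assms
proof (induction \<sigma>)
  case (Cons x xs)
  let ?S = "set xs"
  have x: "x \<notin> ?S" and d: "distinct xs" using Cons.prems by auto
  have "(\<Sum>y\<in>insert x ?S - {z}. u z y) = u z x + (\<Sum>y\<in>?S - {z}. u z y)" if "z \<in> ?S" for z
  proof -
    have "insert x ?S - {z} = insert x (?S - {z})" using that x by auto
    then show ?thesis using x by simp
  qed
  then have "(\<Sum>z\<in>?S. \<Sum>y\<in>insert x ?S - {z}. u z y) =
      (\<Sum>z\<in>?S. u z x) + (\<Sum>z\<in>?S. \<Sum>y\<in>?S - {z}. u z y)"
    by (simp add: sum.distrib)
  then show ?case
    using Cons.IH[OF d] x d by (simp add: sum_list_distinct_conv_sum_set)
qed simp

text \<open>
  Both the cost of an order and the cost of its reversal are at least the minimum, and they add up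
  to the total. If the total is twice the minimum, every order attains the minimum, and swapping
  the first two entries of a list compares \<open>u x y\<close> with \<open>u y x\<close>.
\<close>
lemma min_order_cost:
  fixes u :: "'a \<Rightarrow> 'a \<Rightarrow> nat"
  assumes "finite A"
  defines "m \<equiv> LEAST n. \<exists>\<sigma>. (distinct \<sigma> \<and> set \<sigma> = A) \<and> n = order_cost u \<sigma>"
    and "C \<equiv> \<Sum>x\<in>A. \<Sum>y\<in>A - {x}. u x y"
  shows "2 * m \<le> C"
    and "2 * m = C \<longleftrightarrow> (\<forall>x\<in>A. \<forall>y\<in>A. x \<noteq> y \<longrightarrow> u x y = u y x)"
proof -
  have "\<exists>\<sigma>. distinct \<sigma> \<and> set \<sigma> = A" using finite_distinct_list[OF assms(1)] by blast
  from Least_nat_attained[OF this, of "order_cost u"]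
  obtain \<tau> where \<tau>: "distinct \<tau>" "set \<tau> = A" "m = order_cost u \<tau>"
      "\<And>\<sigma>. distinct \<sigma> \<Longrightarrow> set \<sigma> = A \<Longrightarrow> m \<le> order_cost u \<sigma>"
    unfolding m_def by auto
  have both: "order_cost u \<sigma> + order_cost u (rev \<sigma>) = C" if "distinct \<sigma>" "set \<sigma> = A" for \<sigma>
    using order_cost_plus_rev[OF that(1), of u] that(2) by (simp add: C_def)
  show "2 * m \<le> C"
    using both[OF \<tau>(1,2)] \<tau>(3) \<tau>(4)[of "rev \<tau>"] \<tau>(1,2) by simp
  show "2 * m = C \<longleftrightarrow> (\<forall>x\<in>A. \<forall>y\<in>A. x \<noteq> y \<longrightarrow> u x y = u y x)"
  proof (intro iffI ballI impI)
    fix x y assume eq: "2 * m = C" and xy: "x \<in> A" "y \<in> A" "x \<noteq> y"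
    have const: "order_cost u \<sigma> = m" if "distinct \<sigma>" "set \<sigma> = A" for \<sigma>
      using both[OF that] \<tau>(4)[OF that] \<tau>(4)[of "rev \<sigma>"] that eq by simp
    obtain zs where zs: "distinct zs" "set zs = A - {x, y}"
      using finite_distinct_list[of "A - {x, y}"] assms(1) by auto
    have "order_cost u (x # y # zs) = m" "order_cost u (y # x # zs) = m"
      by (rule const; use zs xy in auto)+
    then show "u x y = u y x" by simp
  next
    assume sym: "\<forall>x\<in>A. \<forall>y\<in>A. x \<noteq> y \<longrightarrow> u x y = u y x"
    have "u (\<tau> ! l) (\<tau> ! k) = u (\<tau> ! k) (\<tau> ! l)" if "l < length \<tau>" "k < l" for k l
    proof -
      have "\<tau> ! k \<in> A" "\<tau> ! l \<in> A" "\<tau> ! k \<noteq> \<tau> ! l"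
        using that \<tau>(1,2) nth_mem[of k \<tau>] nth_mem[of l \<tau>] by (auto simp: nth_eq_iff_index_eq)
      then show ?thesis using sym by simp
    qed
    then have "order_cost u (rev \<tau>) = order_cost u \<tau>"
      unfolding order_cost_rev unfolding order_cost_def by (intro sum.cong) auto
    then show "2 * m = C" using both[OF \<tau>(1,2)] \<tau>(3) by simp
  qed
qed

text \<open>
  A keyed sequence amounts to an order of the keys together with an independent choice of a value
  for every key, so the two parts of its cost are minimised separately.
\<close>
lemma Least_keyed_sequence:
  fixes f :: "nat \<Rightarrow> 'b \<Rightarrow> nat" and g :: "nat list \<Rightarrow> nat"
  assumes ex: "\<And>i. i < r \<Longrightarrow> \<exists>a. P i a"
  shows "(LEAST n. \<exists>as. (distinct (map fst as) \<and> set (map fst as) = {..<r} \<and> (\<forall>(i, a)\<in>set as. P i a)) \<and>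
            n = (\<Sum>(i, a)\<in>set as. f i a) + g (map fst as)) =
         (\<Sum>i<r. LEAST n. \<exists>a. P i a \<and> n = f i a) +
         (LEAST n. \<exists>\<sigma>. (distinct \<sigma> \<and> set \<sigma> = {..<r}) \<and> n = g \<sigma>)"
    (is "(LEAST n. \<exists>as. ?Q as \<and> n = ?F as) = (\<Sum>i<r. ?m i) + ?M")
proof -
  have "\<forall>i\<in>{..<r}. \<exists>a. P i a \<and> ?m i = f i a \<and> (\<forall>b. P i b \<longrightarrow> f i a \<le> f i b)"
    by (intro ballI Least_nat_attained ex) simp
  from bchoice[OF this] obtain a where
    "\<forall>i\<in>{..<r}. P i (a i) \<and> ?m i = f i (a i) \<and> (\<forall>b. P i b \<longrightarrow> f i (a i) \<le> f i b)"
    by (elim exE)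
  then have a: "P i (a i)" "?m i = f i (a i)" "P i b \<Longrightarrow> f i (a i) \<le> f i b" if "i < r" for i b
    using that by simp_all
  have "\<exists>\<sigma>. distinct \<sigma> \<and> set \<sigma> = {..<r}" using finite_distinct_list[of "{..<r}"] by blast
  from Least_nat_attained[OF this, of g]
  obtain \<tau> where \<tau>: "distinct \<tau>" "set \<tau> = {..<r}" "?M = g \<tau>"
      "\<And>\<sigma>. distinct \<sigma> \<Longrightarrow> set \<sigma> = {..<r} \<Longrightarrow> g \<tau> \<le> g \<sigma>"
    by auto
  have reindex: "(\<Sum>(i, b)\<in>set as. h i b) = (\<Sum>i<r. h i (the (map_of as i)))"
    if "distinct (map fst as)" "set (map fst as) = {..<r}" for h :: "nat \<Rightarrow> 'b \<Rightarrow> nat" and as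
  proof -
    have "(\<Sum>(i, b)\<in>set as. h i b) = (\<Sum>x\<in>set as. h (fst x) (the (map_of as (fst x))))"
      using that(1) by (intro sum.cong) (auto simp: map_of_is_SomeI)
    also have "\<dots> = (\<Sum>i\<in>fst ` set as. h i (the (map_of as i)))"
      using that(1) by (subst sum.reindex) (auto simp: distinct_map)
    finally show ?thesis using that(2) by simp
  qed
  show ?thesis
  proof (rule Least_equality)
    let ?as = "map (\<lambda>i. (i, a i)) \<tau>"
    have keys: "map fst ?as = \<tau>" by (simp add: comp_def)
    have "(\<Sum>(i, b)\<in>set ?as. f i b) = (\<Sum>i<r. f i (a i))"
      using \<tau>(2) by (simp add: sum.reindex inj_on_def)
    then have "?F ?as = (\<Sum>i<r. ?m i) + ?M"
      using a(2) \<tau>(3) keys by simp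
    moreover have "?Q ?as" using keys \<tau>(1,2) a(1) by auto
    ultimately show "\<exists>as. ?Q as \<and> (\<Sum>i<r. ?m i) + ?M = ?F as" by metis
  next
    fix n assume "\<exists>as. ?Q as \<and> n = ?F as"
    then obtain as where as: "?Q as" "n = ?F as" by blast
    have "?m i \<le> f i (the (map_of as i))" if "i < r" for i
    proof -
      have "i \<in> fst ` set as" using as(1) that by simp
      then obtain b where b: "(i, b) \<in> set as" by auto
      then have "the (map_of as i) = b" using as(1) by simp
      moreover have "P i b" using b as(1) by auto
      ultimately show ?thesis using a(2,3) that by simp
    qed
    then have "(\<Sum>i<r. ?m i) \<le> (\<Sum>i<r. f i (the (map_of as i)))" by (intro sum_mono) simp
    moreover have "?M \<le> g (map fst as)" using \<tau>(3) \<tau>(4)[of "map fst as"] as(1) by simp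
    ultimately show "(\<Sum>i<r. ?m i) + ?M \<le> n" using as reindex[of as f] by simp
  qed
qed

section \<open>Sorting the crossings by their two strands\<close>

text \<open>
  A crossing is classified by the pair of its lower and upper component. Self-crossings are those
  with equal entries, and the sets of self-, over- and under-crossings are fibres of this pair,
  which makes their disjointness evident.
\<close>
definition level_component :: "link_diagram \<Rightarrow> bool \<Rightarrow> real^3 \<Rightarrow> nat" where
  "level_component D b p = fst (THE x. x \<in> passages D p \<and> over D (fst x) (snd x) = b)"

abbreviation "upper D \<equiv> level_component D True"
abbreviation "lower D \<equiv> level_component D False"

lemma frac_passage:
  assumes "\<And>t. strand E i (t + 1) = strand E i t" "i < ncomp E" "strand E i t = p"
  shows "(i, frac t) \<in> passages E p"
proof -
  have "strand E i (frac t) = p"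
    using periodic_int[of "strand E i" "frac t" "\<lfloor>t\<rfloor>"] assms by (simp add: frac_def)
  then show ?thesis
    using assms(2) frac_lt_1[of t] by (simp add: passages_def)
qed

lemma passages_iff_range:
  assumes "\<And>t. strand E i (t + 1) = strand E i t"
  shows "(\<exists>t. (i, t) \<in> passages E p) \<longleftrightarrow> i < ncomp E \<and> p \<in> range (strand E i)"
proof
  assume "\<exists>t. (i, t) \<in> passages E p"
  then show "i < ncomp E \<and> p \<in> range (strand E i)" by (auto simp: passages_def)
next
  assume "i < ncomp E \<and> p \<in> range (strand E i)"
  then obtain t where "i < ncomp E" "strand E i t = p" by auto
  then show "\<exists>t. (i, t) \<in> passages E p" using frac_passage[of E i t p] assms by blast
qed

text \<open>
  This form mentions only the images of the strands, which do not depend on the orientation.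
\<close>
lemma self_crossings_iff_range:
  assumes "\<And>i t. i < ncomp E \<Longrightarrow> strand E i (t + 1) = strand E i t"
  shows "p \<in> self_crossings E k \<longleftrightarrow>
    p \<in> crossings E \<and> (\<forall>j<ncomp E. p \<in> range (strand E j) \<longrightarrow> j = k)"
proof -
  have "(\<forall>(j, t)\<in>passages E p. j = k) \<longleftrightarrow> (\<forall>j<ncomp E. p \<in> range (strand E j) \<longrightarrow> j = k)"
  proof (intro iffI allI impI)
    fix j assume "\<forall>(j, t)\<in>passages E p. j = k" "j < ncomp E" "p \<in> range (strand E j)"
    then show "j = k" using passages_iff_range[of E j p] assms by auto
  next
    assume "\<forall>j<ncomp E. p \<in> range (strand E j) \<longrightarrow> j = k"
    then show "\<forall>(j, t)\<in>passages E p. j = k" by (auto simp: passages_def)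
  qed
  then show ?thesis by (simp add: self_crossings_def)
qed

lemma reverse_simps [simp]:
  "ncomp (reverse D) = ncomp D"
  "strand (reverse D) i t = strand D i (- t)"
  "over (reverse D) i t = over D i (- t)"
  "reverse (reverse D) = D"
  by (simp_all add: reverse_def)

lemma range_strand_reverse: "range (strand (reverse D) i) = range (strand D i)"
  by (auto simp: image_iff) (metis minus_minus)

text \<open>
  Since reversing is an involution, this inclusion gives equality when applied to both diagrams.
\<close>
lemma crossings_subset_reverse:
  assumes "\<And>i t. i < ncomp E \<Longrightarrow> strand E i (t + 1) = strand E i t"
  shows "crossings E \<subseteq> crossings (reverse E)"
proof
  fix p assume "p \<in> crossings E"
  then obtain i s j t where st: "(i, s) \<in> passages E p" "(j, t) \<in> passages E p" "(i, s) \<noteq> (j, t)"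
    unfolding crossings_def by auto
  \<comment> \<open>The passage of the reversed strand at \<open>- u\<close>, moved back into \<open>[0, 1)\<close>.\<close>
  define g :: "real \<Rightarrow> real" where "g u = (if u = 0 then 0 else 1 - u)" for u
  have g: "(k, g u) \<in> passages (reverse E) p" if "(k, u) \<in> passages E p" for k u
    using that assms[of k "u - 1"] by (auto simp: passages_def g_def)
  have "(i, g s) \<noteq> (j, g t)"
    using st by (auto simp: g_def passages_def split: if_splits)
  then show "p \<in> crossings (reverse E)"
    using g[OF st(1)] g[OF st(2)] unfolding crossings_def by blast
qed

context
  fixes D :: link_diagram
  assumes D: "is_link_diagram D"
begin

lemma strand_periodic: "i < ncomp D \<Longrightarrow> strand D i (t + 1) = strand D i t"
  and over_periodic: "i < ncomp D \<Longrightarrow> over D i (t + 1) = over D i t"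
  using D by (simp_all add: is_link_diagram_def)

lemma finite_crossings: "finite (crossings D)"
  using D by (simp add: is_link_diagram_def)

lemma crossing_passages:
  assumes "p \<in> crossings D"
  obtains i s j t where "passages D p = {(i, s), (j, t)}" "\<not> over D i s" "over D j t"
proof -
  have "card (passages D p) = 2" and ex1: "\<exists>!x. x \<in> passages D p \<and> over D (fst x) (snd x)"
    using D assms by (simp_all add: is_link_diagram_def)
  then obtain x y where xy: "passages D p = {x, y}" "x \<noteq> y" by (auto simp: card_2_iff)
  obtain z where "(z \<in> passages D p \<and> over D (fst z) (snd z)) \<and>
      (\<forall>w. w \<in> passages D p \<and> over D (fst w) (snd w) \<longrightarrow> w = z)"
    using ex1 unfolding Ex1_def by (elim exE)
  then have "over D (fst x) (snd x) \<noteq> over D (fst y) (snd y)" using xy(2) unfolding xy(1) by blast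
  then consider "\<not> over D (fst x) (snd x)" "over D (fst y) (snd y)"
    | "\<not> over D (fst y) (snd y)" "over D (fst x) (snd x)" by blast
  then show ?thesis
  proof cases
    case 1 then show ?thesis using that[of "fst x" "snd x" "fst y" "snd y"] xy by simp
  next
    case 2 then show ?thesis
      using that[of "fst y" "snd y" "fst x" "snd x"] xy by (simp add: insert_commute)
  qed
qed

lemma level_component_eq:
  assumes "passages D p = {(i, s), (j, t)}" "\<not> over D i s" "over D j t"
  shows "lower D p = i" "upper D p = j"
proof -
  have "(THE x. x \<in> passages D p \<and> over D (fst x) (snd x) = False) = (i, s)"
    by (rule the_equality) (use assms in auto)
  then show "lower D p = i" by (simp add: level_component_def)
  have "(THE x. x \<in> passages D p \<and> over D (fst x) (snd x) = True) = (j, t)"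
    by (rule the_equality) (use assms in auto)
  then show "upper D p = j" by (simp add: level_component_def)
qed

lemma self_crossings_by_level:
  "self_crossings D k = {p \<in> crossings D. lower D p = k \<and> upper D p = k}"
proof -
  have "(\<forall>(j, t)\<in>passages D p. j = k) \<longleftrightarrow> lower D p = k \<and> upper D p = k" if p: "p \<in> crossings D" for p
  proof -
    obtain i s j t where ij: "passages D p = {(i, s), (j, t)}" "\<not> over D i s" "over D j t"
      by (rule crossing_passages[OF p])
    then show ?thesis using level_component_eq[OF ij] by auto
  qed
  then show ?thesis unfolding self_crossings_def by blast
qed

lemma mixed_crossings_by_level:
  assumes "k < ncomp D" "l < ncomp D"
  shows "under_crossings D k l = {p \<in> crossings D. k \<noteq> l \<and> lower D p = k \<and> upper D p = l}" (is ?U)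
    and "over_crossings D k l = {p \<in> crossings D. k \<noteq> l \<and> lower D p = l \<and> upper D p = k}" (is ?O)
proof -
  have main: "(k \<noteq> l \<and> p \<in> range (strand D k) \<and> p \<in> range (strand D l) \<and>
        (\<exists>t. strand D k t = p \<and> over D k t = b)) \<longleftrightarrow>
      (k \<noteq> l \<and> level_component D b p = k \<and> level_component D (\<not> b) p = l)"
    if p: "p \<in> crossings D" for p b
  proof -
    obtain i s j t where ij: "passages D p = {(i, s), (j, t)}" "\<not> over D i s" "over D j t"
      by (rule crossing_passages[OF p])
    note lev = level_component_eq[OF ij]
    have at: "strand D i s = p" "strand D j t = p"
    proof -
      have "(i, s) \<in> passages D p" "(j, t) \<in> passages D p" using ij(1) by simp_all
      then show "strand D i s = p" "strand D j t = p" by (simp_all add: passages_def)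
    qed
    have pass: "c = i \<and> over D c u = over D i s \<or> c = j \<and> over D c u = over D j t"
      if "c < ncomp D" "strand D c u = p" for c u
    proof -
      have "(c, frac u) \<in> {(i, s), (j, t)}"
        using frac_passage[OF strand_periodic[OF that(1)] that] ij(1) by simp
      moreover have "over D c (frac u) = over D c u"
        using periodic_int[of "over D c" "frac u" "\<lfloor>u\<rfloor>"] over_periodic[OF that(1)]
        by (simp add: frac_def)
      ultimately show ?thesis by auto
    qed
    show ?thesis
    proof (intro iffI; elim conjE exE)
      fix u assume "k \<noteq> l" "p \<in> range (strand D l)" "strand D k u = p" "over D k u = b"
      moreover from this obtain v where "strand D l v = p" by auto
      ultimately show "k \<noteq> l \<and> level_component D b p = k \<and> level_component D (\<not> b) p = l"
        using pass[OF assms(1), of u] pass[OF assms(2), of v] ij(2,3) lev by (cases b) auto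
    next
      assume "k \<noteq> l" "level_component D b p = k" "level_component D (\<not> b) p = l"
      then show "k \<noteq> l \<and> p \<in> range (strand D k) \<and> p \<in> range (strand D l) \<and>
          (\<exists>t. strand D k t = p \<and> over D k t = b)"
        using at ij(2,3) lev rangeI[of "strand D i" s] rangeI[of "strand D j" t] by (cases b) auto
    qed
  qed
  show ?U using main[of _ False] unfolding under_crossings_def crossings_between_def by auto
  show ?O using main[of _ True] unfolding over_crossings_def crossings_between_def by auto
qed

lemma level_component_less:
  assumes "p \<in> crossings D" shows "lower D p < ncomp D" "upper D p < ncomp D"
proof -
  obtain i s j t where ij: "passages D p = {(i, s), (j, t)}" "\<not> over D i s" "over D j t"
    by (rule crossing_passages[OF assms])
  have "(i, s) \<in> passages D p" "(j, t) \<in> passages D p" using ij(1) by simp_all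
  then have "i < ncomp D" "j < ncomp D" by (simp_all add: passages_def)
  then show "lower D p < ncomp D" "upper D p < ncomp D" using level_component_eq[OF ij] by simp_all
qed

text \<open>
  This makes the results on a single closed curve available for every component.
\<close>
lemma component_curve:
  assumes "i < ncomp D"
  shows "double_point_curve (strand D i) (over D i) (self_crossings D i) (crossings D)"
proof
  show "strand D i (t + 1) = strand D i t" "over D i (t + 1) = over D i t" for t
    using strand_periodic over_periodic assms by simp_all
  show "self_crossings D i \<subseteq> crossings D" by (auto simp: self_crossings_def)
  have "finite (\<Union>p\<in>crossings D. passages D p)"
    using finite_crossings by (auto elim: crossing_passages)
  moreover have "{t. 0 \<le> t \<and> t < 1 \<and> strand D i t \<in> crossings D} \<subseteq> snd ` (\<Union>p\<in>crossings D. passages D p)"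
    using assms by (force simp: passages_def image_iff)
  ultimately show "finite {t. 0 \<le> t \<and> t < 1 \<and> strand D i t \<in> crossings D}"
    by (rule finite_surj)
next
  fix p assume p: "p \<in> self_crossings D i"
  then have "p \<in> crossings D" by (simp add: self_crossings_def)
  then obtain k s j t where kj: "passages D p = {(k, s), (j, t)}" "\<not> over D k s" "over D j t"
    by (rule crossing_passages)
  have "k = i" "j = i" using p kj(1) by (auto simp: self_crossings_def)
  moreover have "{u. 0 \<le> u \<and> u < 1 \<and> strand D i u = p} = {u. (i, u) \<in> passages D p}"
    using assms by (simp add: passages_def)
  ultimately have "{u. 0 \<le> u \<and> u < 1 \<and> strand D i u = p} = {s, t}" using kj(1) by auto
  then show "\<exists>u v. {t. 0 \<le> t \<and> t < 1 \<and> strand D i t = p} = {u, v} \<and> over D i u \<noteq> over D i v"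
    using kj(2,3) \<open>k = i\<close> \<open>j = i\<close> by blast
qed

lemma crossings_component:
  assumes "i < ncomp D"
  shows "crossings (component D i) = self_crossings D i"
proof (intro set_eqI iffI)
  fix p assume "p \<in> crossings (component D i)"
  then obtain s t where st: "(i, s) \<in> passages D p" "(i, t) \<in> passages D p" "s \<noteq> t"
    using assms unfolding crossings_def passages_def component_def by auto
  then have p: "p \<in> crossings D" unfolding crossings_def by blast
  obtain k u j v where kj: "passages D p = {(k, u), (j, v)}" by (rule crossing_passages[OF p])
  then have "k = i" "j = i" using st by auto
  then show "p \<in> self_crossings D i" using p kj by (simp add: self_crossings_def)
next
  fix p assume p: "p \<in> self_crossings D i"
  interpret double_point_curve "strand D i" "over D i" "self_crossings D i" "crossings D"
    by (rule component_curve[OF assms])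
  obtain u v where uv: "{t. 0 \<le> t \<and> t < 1 \<and> strand D i t = p} = {u, v}" "over D i u \<noteq> over D i v"
    using double[OF p] by blast
  have "t \<in> {u, v} \<Longrightarrow> (0, t) \<in> passages (component D i) p" for t
    unfolding uv(1)[symmetric] by (simp add: passages_def component_def)
  then have "(0, u) \<in> passages (component D i) p" "(0, v) \<in> passages (component D i) p" by auto
  moreover have "(0::nat, u) \<noteq> (0, v)" using uv(2) by auto
  ultimately show "p \<in> crossings (component D i)" unfolding crossings_def by blast
qed

lemma alternating_component:
  assumes "i < ncomp D"
  shows "alternating (component D i) \<longleftrightarrow> alternating_along (strand D i) (over D i) (self_crossings D i)"
  unfolding alternating_def alternating_along_def crossings_component[OF assms]
  by (simp add: component_def)

lemma crossings_reverse: "crossings (reverse D) = crossings D"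
proof
  show "crossings D \<subseteq> crossings (reverse D)"
    by (rule crossings_subset_reverse[OF strand_periodic])
  have "strand (reverse D) i (t + 1) = strand (reverse D) i t" if "i < ncomp D" for i t
    using strand_periodic[OF that, of "- t - 1"] by simp
  then show "crossings (reverse D) \<subseteq> crossings D"
    using crossings_subset_reverse[of "reverse D"] by simp
qed

lemma self_crossings_reverse: "self_crossings (reverse D) = self_crossings D"
proof (intro ext set_eqI)
  fix i p
  have "strand (reverse D) i (t + 1) = strand (reverse D) i t" if "i < ncomp D" for i t
    using strand_periodic[OF that, of "- t - 1"] by simp
  then show "p \<in> self_crossings (reverse D) i \<longleftrightarrow> p \<in> self_crossings D i"
    using self_crossings_iff_range[of "reverse D" p i] self_crossings_iff_range[of D p i]
    by (simp add: strand_periodic crossings_reverse range_strand_reverse del: reverse_simps(2))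
qed

lemma under_crossings_reverse: "under_crossings (reverse D) = under_crossings D"
proof (intro ext)
  fix i j
  have "(\<exists>t. strand D i (- t) = p \<and> \<not> over D i (- t)) \<longleftrightarrow> (\<exists>t. strand D i t = p \<and> \<not> over D i t)" for p
    by (metis minus_minus)
  then show "under_crossings (reverse D) i j = under_crossings D i j"
    unfolding under_crossings_def crossings_between_def crossings_reverse range_strand_reverse
    by simp
qed

section \<open>Separating the contributions to the warping degree\<close>

text \<open>
  The two sums are the bounds with which the contributions of the base points and of the order
  are compared.
\<close>
lemma crossing_number_by_level:
  "crossing_number D = (\<Sum>i<ncomp D. card (self_crossings D i)) +
     (\<Sum>i<ncomp D. \<Sum>j\<in>{..<ncomp D} - {i}. card (under_crossings D i j))"
proof -
  let ?r = "ncomp D"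
  define N where "N i j = {p \<in> crossings D. lower D p = i \<and> upper D p = j}" for i j
  have fin: "finite (N i j)" for i j using finite_crossings by (simp add: N_def)
  have "crossings D = (\<Union>x\<in>{..<?r} \<times> {..<?r}. N (fst x) (snd x))"
    using level_component_less by (auto simp: N_def)
  then have "crossing_number D = card (\<Union>x\<in>{..<?r} \<times> {..<?r}. N (fst x) (snd x))"
    by (simp add: crossing_number_def)
  also have "\<dots> = (\<Sum>x\<in>{..<?r} \<times> {..<?r}. card (N (fst x) (snd x)))"
    by (rule card_UN_disjoint) (use fin in \<open>auto simp: N_def\<close>)
  also have "\<dots> = (\<Sum>i<?r. \<Sum>j<?r. card (N i j))"
    by (simp add: sum.cartesian_product split_def)
  also have "\<dots> = (\<Sum>i<?r. card (self_crossings D i) + (\<Sum>j\<in>{..<?r} - {i}. card (under_crossings D i j)))"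
  proof (rule sum.cong[OF refl])
    fix i assume i: "i \<in> {..<?r}"
    have "(\<Sum>j<?r. card (N i j)) = card (N i i) + (\<Sum>j\<in>{..<?r} - {i}. card (N i j))"
      by (rule sum.remove) (use i in auto)
    also have "N i i = self_crossings D i" by (simp add: N_def self_crossings_by_level)
    also have "(\<Sum>j\<in>{..<?r} - {i}. card (N i j)) = (\<Sum>j\<in>{..<?r} - {i}. card (under_crossings D i j))"
      using i by (intro sum.cong refl arg_cong[of _ _ card]) (auto simp: N_def mixed_crossings_by_level)
    finally show "(\<Sum>j<?r. card (N i j)) =
      card (self_crossings D i) + (\<Sum>j\<in>{..<?r} - {i}. card (under_crossings D i j))" .
  qed
  finally show ?thesis by (simp add: sum.distrib)
qed

text \<open>
  The crossings counted are pairwise distinct: the pair of lower and upper component of a crossing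
  determines which member of the union contains it. The family \<open>W\<close> is left open because it is
  needed for the diagram and for its reverse.
\<close>
lemma card_warping_split:
  assumes as: "distinct (map fst as)" "set (map fst as) = {..<ncomp D}"
    and W: "\<And>i a. W i a \<subseteq> self_crossings D i"
  shows "card ((\<Union>(i, a)\<in>set as. W i a) \<union>
      (\<Union>l<length as. \<Union>k<l. under_crossings D (fst (as ! k)) (fst (as ! l)))) =
    (\<Sum>(i, a)\<in>set as. card (W i a)) + order_cost (\<lambda>i j. card (under_crossings D i j)) (map fst as)"
proof -
  let ?\<sigma> = "map fst as"
  let ?U = "\<lambda>l. \<Union>k<l. under_crossings D (?\<sigma> ! k) (?\<sigma> ! l)"
  have in_W: "lower D p = i \<and> upper D p = i" if "p \<in> W i a" for p i a
    using W that unfolding self_crossings_by_level by blast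
  have W_sub: "W i a \<subseteq> crossings D" for i a
    using W unfolding self_crossings_by_level by blast
  have \<sigma>: "?\<sigma> ! k < ncomp D" if "k < length as" for k
  proof -
    have "?\<sigma> ! k \<in> set ?\<sigma>" using that by (intro nth_mem) simp
    then show ?thesis unfolding as(2) by simp
  qed
  have inj: "?\<sigma> ! k = ?\<sigma> ! l \<longleftrightarrow> k = l" if "k < length as" "l < length as" for k l
    using nth_eq_iff_index_eq[OF as(1)] that by simp
  have in_U: "lower D p = ?\<sigma> ! k \<and> upper D p = ?\<sigma> ! l \<and> ?\<sigma> ! k \<noteq> ?\<sigma> ! l"
    if "p \<in> under_crossings D (?\<sigma> ! k) (?\<sigma> ! l)" "k < length as" "l < length as" for p k l
    using that(1) mixed_crossings_by_level(1)[OF \<sigma>[OF that(2)] \<sigma>[OF that(3)]] by simp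
  have fin_U: "finite (under_crossings D i j)" for i j
    using finite_crossings by (simp add: under_crossings_def crossings_between_def)
  have fin_W: "finite (W i a)" for i a
    using finite_subset[OF W_sub finite_crossings] .
  have U: "(\<Union>l<length as. \<Union>k<l. under_crossings D (fst (as ! k)) (fst (as ! l))) = (\<Union>l<length as. ?U l)"
    by auto
  have "card (\<Union>l<length as. ?U l) = (\<Sum>l<length as. card (?U l))"
  proof (rule card_UN_disjoint)
    show "\<forall>l\<in>{..<length as}. \<forall>m\<in>{..<length as}. l \<noteq> m \<longrightarrow> ?U l \<inter> ?U m = {}"
    proof (intro ballI impI, rule ccontr)
      fix l m assume lm: "l \<in> {..<length as}" "m \<in> {..<length as}" "l \<noteq> m" "?U l \<inter> ?U m \<noteq> {}"
      then obtain p k k' where "k < l" "p \<in> under_crossings D (?\<sigma> ! k) (?\<sigma> ! l)"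
        "k' < m" "p \<in> under_crossings D (?\<sigma> ! k') (?\<sigma> ! m)" by blast
      then show False using in_U[of p k l] in_U[of p k' m] inj[of l m] lm by simp
    qed
  qed (use fin_U in auto)
  also have "\<dots> = (\<Sum>l<length as. \<Sum>k<l. card (under_crossings D (?\<sigma> ! k) (?\<sigma> ! l)))"
  proof (rule sum.cong[OF refl], rule card_UN_disjoint)
    fix l assume l: "l \<in> {..<length as}"
    show "\<forall>k\<in>{..<l}. \<forall>k'\<in>{..<l}. k \<noteq> k' \<longrightarrow>
        under_crossings D (?\<sigma> ! k) (?\<sigma> ! l) \<inter> under_crossings D (?\<sigma> ! k') (?\<sigma> ! l) = {}"
    proof (intro ballI impI, rule ccontr)
      fix k k' assume k: "k \<in> {..<l}" "k' \<in> {..<l}" "k \<noteq> k'"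
        "under_crossings D (?\<sigma> ! k) (?\<sigma> ! l) \<inter> under_crossings D (?\<sigma> ! k') (?\<sigma> ! l) \<noteq> {}"
      then obtain p where "p \<in> under_crossings D (?\<sigma> ! k) (?\<sigma> ! l)"
        "p \<in> under_crossings D (?\<sigma> ! k') (?\<sigma> ! l)" by blast
      then show False using in_U[of p k l] in_U[of p k' l] inj[of k k'] k l by simp
    qed
  qed (use fin_U in auto)
  also have "\<dots> = order_cost (\<lambda>i j. card (under_crossings D i j)) ?\<sigma>"
    by (simp only: order_cost_def length_map)
  finally have card_U: "card (\<Union>l<length as. ?U l) = order_cost (\<lambda>i j. card (under_crossings D i j)) ?\<sigma>" .
  have "card (\<Union>x\<in>set as. W (fst x) (snd x)) = (\<Sum>x\<in>set as. card (W (fst x) (snd x)))"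
  proof (rule card_UN_disjoint)
    show "\<forall>x\<in>set as. \<forall>y\<in>set as. x \<noteq> y \<longrightarrow> W (fst x) (snd x) \<inter> W (fst y) (snd y) = {}"
    proof (intro ballI impI, rule ccontr)
      fix x y assume xy: "x \<in> set as" "y \<in> set as" "x \<noteq> y" "W (fst x) (snd x) \<inter> W (fst y) (snd y) \<noteq> {}"
      then obtain p where "p \<in> W (fst x) (snd x)" "p \<in> W (fst y) (snd y)" by blast
      from in_W[OF this(1)] in_W[OF this(2)] have "fst x = fst y" by simp
      then show False using as(1) xy(1-3) by (auto simp: distinct_map inj_on_def)
    qed
  qed (use fin_W in auto)
  then have card_W: "card (\<Union>(i, a)\<in>set as. W i a) = (\<Sum>(i, a)\<in>set as. card (W i a))"
    by (simp add: split_def)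
  have "p \<notin> (\<Union>l<length as. ?U l)" if "p \<in> W i a" for p i a
  proof
    assume "p \<in> (\<Union>l<length as. ?U l)"
    then obtain l k where "l < length as" "k < l" "p \<in> under_crossings D (?\<sigma> ! k) (?\<sigma> ! l)" by blast
    then show False using in_U[of p k l] in_W[OF that] by auto
  qed
  then have "(\<Union>(i, a)\<in>set as. W i a) \<inter> (\<Union>l<length as. ?U l) = {}" by blast
  then have "card ((\<Union>(i, a)\<in>set as. W i a) \<union> (\<Union>l<length as. ?U l)) =
      card (\<Union>(i, a)\<in>set as. W i a) + card (\<Union>l<length as. ?U l)"
    using fin_U fin_W by (intro card_Un_disjoint) auto
  then show ?thesis using card_U card_W unfolding U by simp
qed

text \<open>
  Applied with \<open>E\<close> equal to \<open>D\<close> and to \<open>reverse D\<close>. The order contributes the same amount in both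
  cases, because under-crossings between components do not depend on the orientation.
\<close>
lemma warping_degree_split:
  assumes "ncomp E = ncomp D" "crossings E = crossings D"
    and "self_crossings E = self_crossings D" "under_crossings E = under_crossings D"
    and "\<And>i. i < ncomp D \<Longrightarrow> \<exists>a. strand E i a \<notin> crossings D"
  shows "warping_degree E =
    (\<Sum>i<ncomp D. LEAST n. \<exists>a. strand E i a \<notin> crossings D \<and> n = card (warping_self_crossings E i a)) +
    (LEAST n. \<exists>\<sigma>. (distinct \<sigma> \<and> set \<sigma> = {..<ncomp D}) \<and>
       n = order_cost (\<lambda>i j. card (under_crossings D i j)) \<sigma>)"
proof -
  have W: "warping_self_crossings E i a \<subseteq> self_crossings D i" for i a
    using assms(3) by (auto simp: warping_self_crossings_def)
  have "base_point_sequence E as \<and> n = warping_degree_at E as \<longleftrightarrow>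
      (distinct (map fst as) \<and> set (map fst as) = {..<ncomp D} \<and>
        (\<forall>(i, a)\<in>set as. strand E i a \<notin> crossings D)) \<and>
      n = (\<Sum>(i, a)\<in>set as. card (warping_self_crossings E i a)) +
        order_cost (\<lambda>i j. card (under_crossings D i j)) (map fst as)" for as n
  proof (cases "distinct (map fst as) \<and> set (map fst as) = {..<ncomp D}")
    case True
    then show ?thesis
      using card_warping_split[of as "warping_self_crossings E", OF _ _ W]
      unfolding base_point_sequence_def warping_degree_at_def warping_crossings_def assms(1,2,4)
      by simp
  next
    case False
    then show ?thesis unfolding base_point_sequence_def assms(1) by blast
  qed
  then show ?thesis
    unfolding warping_degree_def
    by (simp only: Least_keyed_sequence[where P = "\<lambda>i a. strand E i a \<notin> crossings D" and
        f = "\<lambda>i a. card (warping_self_crossings E i a)" and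
        g = "order_cost (\<lambda>i j. card (under_crossings D i j))", OF assms(5)])
qed

end

text \<open>
  Both sides are now sums over the components plus an order term, with \<open>\<le>\<close> between corresponding
  terms. Equality of the totals therefore forces equality in each of them, and these equalities
  are the two halves of property C.
\<close>
theorem theorem1p3:
  fixes D :: link_diagram
  assumes "is_link_diagram D"
  shows "warping_degree D + warping_degree (reverse D) + sr D \<le> crossing_number D \<and>
    (warping_degree D + warping_degree (reverse D) + sr D = crossing_number D \<longleftrightarrow> property_C D)"
proof -
  let ?r = "ncomp D"
  let ?X = "self_crossings D"
  define u where "u i j = card (under_crossings D i j)" for i j
  define m where "m = (LEAST n. \<exists>\<sigma>. (distinct \<sigma> \<and> set \<sigma> = {..<?r}) \<and> n = order_cost u \<sigma>)"
  define lo where "lo i = (LEAST n. \<exists>a. strand D i a \<notin> crossings D \<and>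
      n = card (first_met_under (strand D i) (over D i) (?X i) a))" for i
  define lo_rev where "lo_rev i = (LEAST n. \<exists>a. strand D i a \<notin> crossings D \<and>
      n = card (?X i - first_met_under (strand D i) (over D i) (?X i) a))" for i
  define C where "C = (\<Sum>i<?r. \<Sum>j\<in>{..<?r} - {i}. u i j)"
  have ex: "\<exists>a. strand D i a \<notin> crossings D" if "i < ?r" for i
    using double_point_curve.base_point_exists[OF component_curve[OF assms that]] .
  have met: "warping_self_crossings E i a = first_met_under (strand E i) (over E i) (self_crossings E i) a"
    for E i a
    by (simp add: warping_self_crossings_def first_met_under_def)
  have degree: "warping_degree D = (\<Sum>i<?r. lo i) + m"
    using warping_degree_split[OF assms, of D] ex by (simp add: lo_def m_def u_def[abs_def] met)
  have lo_rev_eq: "(LEAST n. \<exists>a. strand (reverse D) i a \<notin> crossings D \<and>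
      n = card (warping_self_crossings (reverse D) i a)) = lo_rev i" if i: "i < ?r" for i
  proof -
    interpret double_point_curve "strand D i" "over D i" "?X i" "crossings D"
      by (rule component_curve[OF assms i])
    have rev: "warping_self_crossings (reverse D) i (- a) = ?X i - warp a" if "strand D i a \<notin> crossings D" for a
    proof -
      have "strand D i a \<notin> ?X i" using that subset by blast
      then show ?thesis
        using warp_reverse unfolding met self_crossings_reverse[OF assms]
        by (simp add: reverse_def)
    qed
    have "(\<exists>a. strand (reverse D) i a \<notin> crossings D \<and> n = card (warping_self_crossings (reverse D) i a))
        \<longleftrightarrow> (\<exists>a. strand D i a \<notin> crossings D \<and> n = card (?X i - warp a))" for n
      by (metis rev reverse_simps(2) minus_minus)
    then show ?thesis by (simp only: lo_rev_def)
  qed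
  have "\<exists>a. strand (reverse D) i a \<notin> crossings D" if "i < ?r" for i
    using ex[OF that] by (metis reverse_simps(2) minus_minus)
  then have degree_rev: "warping_degree (reverse D) = (\<Sum>i<?r. lo_rev i) + m"
    using warping_degree_split[OF assms, of "reverse D"] lo_rev_eq
    by (simp add: crossings_reverse[OF assms] self_crossings_reverse[OF assms]
        under_crossings_reverse[OF assms] m_def u_def[abs_def] del: reverse_simps(2))
  have sr: "sr D = (\<Sum>i<?r. of_bool (?X i \<noteq> {}))"
  proof -
    have "{..<?r} \<inter> {i. ?X i \<noteq> {}} = {i. i < ?r \<and> ?X i \<noteq> {}}" by auto
    then show ?thesis unfolding sr_def by (simp add: sum_of_bool_eq)
  qed
  let ?S = "\<lambda>i. lo i + lo_rev i + of_bool (?X i \<noteq> {})"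
  have lhs: "warping_degree D + warping_degree (reverse D) + sr D = (\<Sum>i<?r. ?S i) + 2 * m"
    unfolding degree degree_rev sr by (simp add: sum.distrib)
  have rhs: "crossing_number D = (\<Sum>i<?r. card (?X i)) + C"
    unfolding crossing_number_by_level[OF assms] C_def u_def ..
  have span: "?S i \<le> card (?X i)"
    and span_eq: "?S i = card (?X i) \<longleftrightarrow> alternating (component D i)" if "i < ?r" for i
    using double_point_curve.warping_span[OF component_curve[OF assms that]]
    unfolding lo_def lo_rev_def alternating_component[OF assms that] by simp_all
  have sum_le: "(\<Sum>i<?r. ?S i) \<le> (\<Sum>i<?r. card (?X i))"
    by (rule sum_mono) (use span in auto)
  have sum_eq: "(\<Sum>i<?r. ?S i) = (\<Sum>i<?r. card (?X i)) \<longleftrightarrow> (\<forall>i<?r. alternating (component D i))"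
  proof
    assume "(\<Sum>i<?r. ?S i) = (\<Sum>i<?r. card (?X i))"
    then have "?S i = card (?X i)" if "i < ?r" for i
      by (rule sum_mono_inv) (use span that in auto)
    then show "\<forall>i<?r. alternating (component D i)" using span_eq by blast
  qed (use span_eq in \<open>auto intro!: sum.cong\<close>)
  \<comment> \<open>Over-crossings of \<open>i\<close> with \<open>j\<close> are the under-crossings of \<open>j\<close> with \<open>i\<close>, so the balance
    required by property C is the symmetry of \<open>u\<close>.\<close>
  have over_u: "card (over_crossings D i j) = u j i" if "i < ?r" "j < ?r" for i j
    unfolding u_def mixed_crossings_by_level(2)[OF assms that]
      mixed_crossings_by_level(1)[OF assms that(2,1)] by (rule arg_cong[of _ _ card]) auto
  have order_le: "2 * m \<le> C" and
    order_eq: "2 * m = C \<longleftrightarrow> (\<forall>i\<in>{..<?r}. \<forall>j\<in>{..<?r}. i \<noteq> j \<longrightarrow> u i j = u j i)"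
    unfolding m_def C_def by (rule min_order_cost, simp)+
  have "property_C D \<longleftrightarrow> (\<Sum>i<?r. ?S i) = (\<Sum>i<?r. card (?X i)) \<and> 2 * m = C"
    unfolding property_C_def sum_eq order_eq using over_u by (auto simp: u_def)
  then show ?thesis unfolding lhs rhs using sum_le order_le by linarith
qed

end
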